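(* Every underclosed simplicial complex is weakly-closed and skeleton-weakly-chordal. The converse is false: there is a simplicial complex that is weakly-closed and skeleton-weakly-chordal but not underclosed.
   Context: Simplicial complexes are finite and not necessarily pure. A vertex labeling of a complex with $n$ vertices is a bijection of its vertices with $[n]=\{1,\dots,n\}$; $\min F,\max F$ denote the smallest and largest labels in $F$; the size of a face is its number of vertices. Two faces of the same dimension $k$ are adjacent if their intersection has dimension $k-1$. For sets $G=\{g_0<\dots<g_k\}$, $F=\{f_0<\dots<f_k\}$ of the same size, $G\le F$ componentwise means $g_i\le f_i$ for all $i$. A complex $\Delta$ with $n$ vertices is: - underclosed, if it has a labeling such that for every facet $F$ of $\Delta$ and every $G\subseteq[n]$ with $|G|=|F|$, if $\min G=\min F$ and $G\le F$ componentwise, then $G\in\Delta$; - weakly-closed, if it has a labeling such that for every facet $F$ of $\Delta$ and every integer $g\notin F$ with $\min F<g<\max F$, $\Delta$ contains some face $G$ of the same size as $F$, adjacent to $F$, and containing $g$; - skeleton-weakly-chordal, if it has a labeling such that for every two faces $f\neq g$ of $\Delta$ with the same size and same maximum, $\Delta$ contains some face $h$ with $|h|=|f|$ and $h\subseteq (f\cup g)\setminus\{\max f\}$. The labelings witnessing different properties may be different. *)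

theory Defs imports Main begin

text \<open>
  Finite abstract simplicial complexes, given by their set of faces (the empty face included).
  The vertices are the elements of \<open>\<Union>D\<close>, so there are no ghost vertices.
\<close>

definition simplicial_complex :: "'a set set \<Rightarrow> bool" where
  "simplicial_complex D \<longleftrightarrow>
     finite D \<and> (\<forall>F\<in>D. finite F) \<and> (\<forall>F\<in>D. \<forall>G. G \<subseteq> F \<longrightarrow> G \<in> D)"

definition vertices :: "'a set set \<Rightarrow> 'a set" where
  "vertices D = \<Union>D"

definition facet :: "'a set set \<Rightarrow> 'a set \<Rightarrow> bool" where
  "facet D F \<longleftrightarrow> F \<in> D \<and> (\<forall>G\<in>D. F \<subseteq> G \<longrightarrow> G = F)"

definition face_dim :: "'a set \<Rightarrow> int" where
  "face_dim F = int (card F) - 1"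

definition adjacent :: "'a set \<Rightarrow> 'a set \<Rightarrow> bool" where
  "adjacent F G \<longleftrightarrow> face_dim F = face_dim G \<and> face_dim (F \<inter> G) = face_dim F - 1"

definition labeling :: "'a set set \<Rightarrow> ('a \<Rightarrow> nat) \<Rightarrow> bool" where
  "labeling D l \<longleftrightarrow> bij_betw l (vertices D) {1..card (vertices D)}"

definition relabel :: "('a \<Rightarrow> nat) \<Rightarrow> 'a set set \<Rightarrow> nat set set" where
  "relabel l D = (\<lambda>F. l ` F) ` D"

definition comp_le :: "nat set \<Rightarrow> nat set \<Rightarrow> bool" where
  "comp_le G F \<longleftrightarrow> list_all2 (\<le>) (sorted_list_of_set G) (sorted_list_of_set F)"

text \<open>
  The following three predicates concern complexes whose vertex set is already
  \<open>{1..card (vertices D)}\<close>.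
\<close>

definition underclosed_labels :: "nat set set \<Rightarrow> bool" where
  "underclosed_labels D \<longleftrightarrow>
     (\<forall>F G. facet D F \<and> G \<subseteq> {1..card (vertices D)} \<and> card G = card F
        \<and> Min G = Min F \<and> comp_le G F \<longrightarrow> G \<in> D)"

text \<open>
  The guard \<open>F \<noteq> {}\<close> only matters for the complex \<open>{{}}\<close>, where \<open>Min {}\<close> and \<open>Max {}\<close>
  are unspecified numbers and the condition is meant to be vacuous.
\<close>

definition weakly_closed_labels :: "nat set set \<Rightarrow> bool" where
  "weakly_closed_labels D \<longleftrightarrow>
     (\<forall>F g. facet D F \<and> F \<noteq> {} \<and> g \<notin> F \<and> Min F < g \<and> g < Max F
        \<longrightarrow> (\<exists>G\<in>D. card G = card F \<and> adjacent G F \<and> g \<in> G))"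

definition skeleton_weakly_chordal_labels :: "nat set set \<Rightarrow> bool" where
  "skeleton_weakly_chordal_labels D \<longleftrightarrow>
     (\<forall>f\<in>D. \<forall>g\<in>D. f \<noteq> g \<and> card f = card g \<and> Max f = Max g
        \<longrightarrow> (\<exists>h\<in>D. card h = card f \<and> h \<subseteq> (f \<union> g) - {Max f}))"

definition underclosed :: "'a set set \<Rightarrow> bool" where
  "underclosed D \<longleftrightarrow> (\<exists>l. labeling D l \<and> underclosed_labels (relabel l D))"

definition weakly_closed :: "'a set set \<Rightarrow> bool" where
  "weakly_closed D \<longleftrightarrow> (\<exists>l. labeling D l \<and> weakly_closed_labels (relabel l D))"

definition skeleton_weakly_chordal :: "'a set set \<Rightarrow> bool" where
  "skeleton_weakly_chordal D \<longleftrightarrow>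
     (\<exists>l. labeling D l \<and> skeleton_weakly_chordal_labels (relabel l D))"

end

theory Submission imports Defs "HOL-Combinatorics.Transposition" begin

text \<open>
  For the implication, the given labeling itself works: replacing the maximum of a facet \<open>F\<close> by
  some \<open>v \<notin> F\<close> with \<open>Min F < v < Max F\<close> yields a componentwise smaller set with the same
  minimum. For chordality one takes \<open>v \<in> g - f\<close>, where \<open>f\<close> is the face with the smaller minimum,
  and replaces \<open>Max f\<close> by \<open>v\<close>.

  The counterexample is the complete graph on five vertices together with the triangles
  123, 124, 135 and 345, of which no three are pairwise adjacent. Each vertex lies in at least two
  of them, so an underclosed labeling makes \<open>{1,2,3}\<close> and \<open>{1,2,4}\<close> faces; then none of
  \<open>{1,2,5}\<close>, \<open>{1,3,4}\<close>, \<open>{2,3,4}\<close> is one, which leaves \<open>{3,4,5}\<close> as the only possible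
  further triangle.
\<close>

section \<open>Underclosed complexes\<close>

lemma sorted_imp_list_all2_insort:
  fixes v :: "'b::linorder"
  assumes "sorted (xs @ [m])" "v \<le> m"
  shows "list_all2 (\<le>) (insort v xs) (xs @ [m])"
  using assms
proof (induction xs arbitrary: v)
  case (Cons x xs)
  show ?case
  proof (cases "v \<le> x")
    case True
    \<comment> \<open>The induction hypothesis is used for \<open>x\<close> in place of
      \<open>v\<close>: it compares \<open>x # xs\<close> with its shift \<open>xs @ [m]\<close>,
      which is what remains once \<open>v\<close> takes the place of \<open>x\<close>.\<close>
    have "list_all2 (\<le>) (insort x xs) (xs @ [m])"
      using Cons by auto
    moreover have "insort x xs = x # xs"
      using Cons.prems(1) by (simp add: insort_is_Cons)
    ultimately show ?thesis using True by simp
  next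
    case False
    then show ?thesis using Cons by auto
  qed
qed simp

lemma comp_le_replace_Max:
  assumes fin: "finite F" and ne: "F \<noteq> {}" and v: "v \<notin> F" "v < Max F"
  shows "comp_le (insert v (F - {Max F})) F"
proof -
  let ?m = "Max F" and ?xs = "sorted_list_of_set (F - {Max F})"
  have sorted: "sorted (?xs @ [?m])"
    using fin by (auto simp: sorted_append)
  moreover have "distinct (?xs @ [?m])" "set (?xs @ [?m]) = F"
    using fin Max_in[OF fin ne] by auto
  ultimately have "sorted_list_of_set F = ?xs @ [?m]"
    by (metis sorted_list_of_set.idem_if_sorted_distinct)
  moreover have "sorted_list_of_set (insert v (F - {?m})) = insort v ?xs"
    using fin v by (simp add: sorted_list_of_set_insert)
  ultimately show ?thesis
    unfolding comp_le_def using sorted_imp_list_all2_insort[OF sorted] v by simp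
qed

lemma card_replace_Max:
  assumes "finite F" "F \<noteq> {}" "v \<notin> F"
  shows "card (insert v (F - {Max F})) = card F"
  using assms card_gt_0_iff[of F] by simp

text \<open>Both closure properties use underclosedness only through this exchange.\<close>

lemma underclosed_labels_replace_Max:
  assumes D: "underclosed_labels D" and V: "vertices D = {1..card (vertices D)}"
    and F: "facet D F" "finite F" "F \<noteq> {}"
    and v: "v \<in> vertices D" "v \<notin> F" "Min F < v" "v < Max F"
  shows "insert v (F - {Max F}) \<in> D"
proof -
  let ?G = "insert v (F - {Max F})"
  have "F \<subseteq> vertices D" using F by (auto simp: facet_def vertices_def)
  then have "?G \<subseteq> {1..card (vertices D)}" using v V by auto
  \<comment> \<open>Since \<open>Min F < v < Max F\<close>, the minimum differs from the deleted
    maximum and stays below the new element.\<close>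
  moreover have "Min ?G = Min F"
    using F v by (intro Min_eqI) (auto simp: order.strict_implies_order)
  ultimately show ?thesis
    using D F comp_le_replace_Max[of F v] card_replace_Max[of F v] v
    unfolding underclosed_labels_def by blast
qed

lemma underclosed_labels_imp_weakly_closed_labels:
  assumes C: "simplicial_complex D" and D: "underclosed_labels D"
    and V: "vertices D = {1..card (vertices D)}"
  shows "weakly_closed_labels D"
  unfolding weakly_closed_labels_def
proof (intro allI impI, elim conjE)
  fix F g assume F: "facet D F" "F \<noteq> {}" and g: "g \<notin> F" "Min F < g" "g < Max F"
  let ?G = "insert g (F - {Max F})"
  have fin: "finite F" and FD: "F \<in> D"
    using C F by (auto simp: simplicial_complex_def facet_def)
  \<comment> \<open>The vertices form an interval, so an integer between the two vertices
    \<open>Min F\<close> and \<open>Max F\<close> is itself a vertex.\<close>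
  have "F \<subseteq> vertices D" using FD by (auto simp: vertices_def)
  then have "Min F \<in> vertices D" "Max F \<in> vertices D"
    using Min_in[OF fin F(2)] Max_in[OF fin F(2)] by auto
  then have "Min F \<ge> 1" "Max F \<le> card (vertices D)"
    using V by (metis atLeastAtMost_iff)+
  then have gV: "g \<in> vertices D" using g by (subst V) auto
  have "?G \<in> D"
    using underclosed_labels_replace_Max[OF D V F(1) fin F(2) gV g] .
  moreover have "card ?G = card F"
    using card_replace_Max[OF fin F(2) g(1)] .
  moreover have "?G \<inter> F = F - {Max F}" using g by auto
  then have "face_dim (?G \<inter> F) = face_dim F - 1"
    using fin F by (simp add: face_dim_def card_Diff_singleton card_gt_0_iff of_nat_diff Suc_leI)
  ultimately show "\<exists>G\<in>D. card G = card F \<and> adjacent G F \<and> g \<in> G"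
    by (intro bexI[of _ ?G]) (auto simp: adjacent_def face_dim_def)
qed

text \<open>Bridges underclosedness, which speaks of facets, and chordality, which speaks of all
  faces.\<close>

lemma exists_facet_superset:
  assumes "simplicial_complex D" "f \<in> D"
  obtains F where "facet D F" "f \<subseteq> F"
  using finite_has_maximal2[of D f] assms
  by (auto simp: simplicial_complex_def facet_def)

text \<open>The face \<open>f\<close> is enlarged to a facet \<open>F\<close>. If \<open>v\<close>
  lies in \<open>F\<close>, then so does all of \<open>h\<close>. Otherwise \<open>Min F\<close>
  \<le> \<open>Min f\<close> \<le> \<open>Min g\<close> \<le> \<open>v\<close> and
  \<open>v < Max f\<close> \<le> \<open>Max F\<close>, so \<open>v\<close> can be exchanged for
  \<open>Max F\<close>, and the resulting face contains \<open>h\<close>.\<close>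

lemma underclosed_labels_imp_skeleton_weakly_chordal_labels:
  assumes C: "simplicial_complex D" and D: "underclosed_labels D"
    and V: "vertices D = {1..card (vertices D)}"
  shows "skeleton_weakly_chordal_labels D"
proof -
  have step: "\<exists>h\<in>D. card h = card f \<and> h \<subseteq> (f \<union> g) - {Max f}"
    if fg: "f \<in> D" "g \<in> D" "f \<noteq> g" "card f = card g" "Max f = Max g" and le: "Min f \<le> Min g"
    for f g
  proof -
    have fin: "finite f" "finite g" using C fg by (auto simp: simplicial_complex_def)
    \<comment> \<open>Distinct sets of the same size cannot be empty, so \<open>Min\<close> and
      \<open>Max\<close> are genuine here.\<close>
    then have ne: "f \<noteq> {}" "g \<noteq> {}" using fg by auto
    have "\<not> g \<subseteq> f" using fg fin by (metis card_subset_eq)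
    then obtain v where v: "v \<in> g" "v \<notin> f" by blast
    let ?h = "insert v (f - {Max f})"
    have "v \<noteq> Max f" using v fin ne by (metis Max_in)
    then have vm: "v < Max f" using v fin fg by (simp add: order.not_eq_order_implies_strict)
    obtain F where F: "facet D F" "f \<subseteq> F" using exists_facet_superset[OF C fg(1)] .
    then have FD: "F \<in> D" and finF: "finite F" and neF: "F \<noteq> {}"
      using C ne by (auto simp: facet_def simplicial_complex_def)
    have h: "card ?h = card f" "?h \<subseteq> (f \<union> g) - {Max f}"
      using card_replace_Max[OF fin(1) ne(1) v(2)] v vm by auto
    have "?h \<in> D"
    proof (cases "v \<in> F")
      case True
      then have "?h \<subseteq> F" using F by auto
      then show ?thesis using FD C unfolding simplicial_complex_def by blast
    next
      case False
      have "Min F \<le> Min f" using F finF ne by (simp add: Min_antimono)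
      also have "\<dots> \<le> v" using le v fin by (meson Min_le order_trans)
      finally have "Min F < v" using False finF neF by (metis Min_in order.not_eq_order_implies_strict)
      moreover have mF: "Max f \<le> Max F" using F finF ne by (simp add: Max_mono)
      moreover have "v \<in> vertices D" using v fg by (auto simp: vertices_def)
      ultimately have *: "insert v (F - {Max F}) \<in> D"
        using underclosed_labels_replace_Max[OF D V F(1) finF neF] False vm by auto
      \<comment> \<open>Whether or not \<open>Max f\<close> equals \<open>Max F\<close>, the other
        elements of \<open>f\<close> lie strictly below \<open>Max F\<close>.\<close>
      have "f - {Max f} \<subseteq> F - {Max F}"
      proof
        fix x assume x: "x \<in> f - {Max f}"
        then have "x < Max f" using fin by (simp add: order.not_eq_order_implies_strict)
        then show "x \<in> F - {Max F}" using x F mF by auto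
      qed
      then have "?h \<subseteq> insert v (F - {Max F})" by auto
      then show ?thesis using * C unfolding simplicial_complex_def by blast
    qed
    then show ?thesis using h by blast
  qed
  show ?thesis
    unfolding skeleton_weakly_chordal_labels_def
  proof (intro ballI impI, elim conjE)
    fix f g assume fg: "f \<in> D" "g \<in> D" "f \<noteq> g" "card f = card g" "Max f = Max g"
    show "\<exists>h\<in>D. card h = card f \<and> h \<subseteq> (f \<union> g) - {Max f}"
    \<comment> \<open>As the maxima and sizes agree, the claim is symmetric in \<open>f\<close> and
      \<open>g\<close>.\<close>
    proof (cases "Min f \<le> Min g")
      case True
      then show ?thesis using step[of f g] fg by simp
    next
      case False
      then show ?thesis using step[of g f] fg by (simp add: Un_commute)
    qed
  qed
qed

section \<open>Transfer to arbitrary complexes along a labeling\<close>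

lemma vertices_relabel: "vertices (relabel l D) = l ` vertices D"
  by (auto simp: vertices_def relabel_def)

lemma vertices_relabel_labeling:
  assumes "labeling D l"
  shows "vertices (relabel l D) = {1..card (vertices D)}"
    and "vertices (relabel l D) = {1..card (vertices (relabel l D))}"
  using assms by (simp_all add: vertices_relabel labeling_def bij_betw_def)

lemma simplicial_complex_relabel:
  assumes "simplicial_complex D"
  shows "simplicial_complex (relabel l D)"
  using assms by (auto simp: simplicial_complex_def relabel_def subset_image_iff)

lemma underclosed_imp:
  assumes "simplicial_complex D" "underclosed D"
  shows "weakly_closed D \<and> skeleton_weakly_chordal D"
  using assms underclosed_labels_imp_weakly_closed_labels
    underclosed_labels_imp_skeleton_weakly_chordal_labels
    simplicial_complex_relabel vertices_relabel_labeling(2)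
  unfolding underclosed_def weakly_closed_def skeleton_weakly_chordal_def by metis

section \<open>The counterexample\<close>

text \<open>Because every set of size at most 2 is a face, all conditions on edges hold under any
  labeling and only the triangles in \<open>T\<close> matter.\<close>

definition triangles_with_K5 :: "nat set set \<Rightarrow> nat set set" where
  "triangles_with_K5 T = {F. F \<subseteq> {1..5} \<and> card F \<le> 2} \<union> T"

definition triples :: "nat set set \<Rightarrow> bool" where
  "triples T \<longleftrightarrow> (\<forall>F\<in>T. F \<subseteq> {1..5} \<and> card F = 3)"

lemma triangles_with_K5_face:
  assumes "triples T" "F \<in> triangles_with_K5 T"
  shows "F \<subseteq> {1..5}" "finite F" "card F \<le> 3"
proof -
  show "F \<subseteq> {1..5}" "card F \<le> 3"
    using assms by (auto simp: triangles_with_K5_def triples_def)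
  then show "finite F" using finite_subset by blast
qed

lemma simplicial_complex_triangles_with_K5:
  assumes "triples T"
  shows "simplicial_complex (triangles_with_K5 T)"
proof -
  note face = triangles_with_K5_face[OF assms]
  have "triangles_with_K5 T \<subseteq> Pow {1..5}" using face(1) by blast
  then have "finite (triangles_with_K5 T)" by (rule finite_subset) simp
  moreover have "G \<in> triangles_with_K5 T" if "F \<in> triangles_with_K5 T" "G \<subseteq> F" for F G
  proof (cases "G = F")
    case False
    \<comment> \<open>A proper subset of a face has at most two elements, hence belongs to the graph
      part.\<close>
    then have "card G < card F" using that face(2)[of F] by (simp add: psubset_card_mono psubsetI)
    then show ?thesis
      using face[OF that(1)] that(2) by (auto simp: triangles_with_K5_def)
  qed (use that in simp)
  ultimately show ?thesis using face(2) unfolding simplicial_complex_def by blast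
qed

lemma vertices_triangles_with_K5:
  assumes "triples T"
  shows "vertices (triangles_with_K5 T) = {1..5}"
proof
  show "vertices (triangles_with_K5 T) \<subseteq> {1..5}"
    using triangles_with_K5_face(1)[OF assms] unfolding vertices_def by blast
  show "{1..5} \<subseteq> vertices (triangles_with_K5 T)"
  proof
    fix x :: nat assume "x \<in> {1..5}"
    then have "{x} \<in> triangles_with_K5 T" by (simp add: triangles_with_K5_def)
    then show "x \<in> vertices (triangles_with_K5 T)" by (auto simp: vertices_def)
  qed
qed

text \<open>A permutation of the five vertices preserves the graph part, so varying the labeling
  amounts to varying \<open>T\<close>.\<close>

lemma relabel_triangles_with_K5:
  assumes T: "triples T" and l: "bij_betw l {1..5} {1..5}"
  shows "relabel l (triangles_with_K5 T) = triangles_with_K5 (relabel l T)" "triples (relabel l T)"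
proof -
  have card: "card (l ` F) = card F" if "F \<subseteq> {1..5}" for F
    using that l by (meson bij_betw_def card_image inj_on_subset)
  have img: "l ` F \<subseteq> {1..5}" if "F \<subseteq> {1..5}" for F
    using that l unfolding bij_betw_def by blast
  show "triples (relabel l T)"
    using T card img unfolding triples_def relabel_def by simp
  have "(\<lambda>F. l ` F) ` {F. F \<subseteq> {1..5} \<and> card F \<le> 2} = {F. F \<subseteq> {1..5} \<and> card F \<le> 2}" (is "?L = ?R")
  proof
    show "?L \<subseteq> ?R" using card img by auto
    show "?R \<subseteq> ?L"
    proof
      fix G assume G: "G \<in> ?R"
      then obtain F where "F \<subseteq> {1..5}" "G = l ` F"
        using l unfolding bij_betw_def by (metis (lifting) mem_Collect_eq subset_image_iff)
      then show "G \<in> ?L" using card[of F] G by auto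
    qed
  qed
  then show "relabel l (triangles_with_K5 T) = triangles_with_K5 (relabel l T)"
    by (simp add: relabel_def triangles_with_K5_def image_Un)
qed

lemma facet_triangle:
  assumes "triples T" "F \<in> T"
  shows "facet (triangles_with_K5 T) F"
  unfolding facet_def
proof (intro conjI ballI impI)
  show "F \<in> triangles_with_K5 T" using assms by (simp add: triangles_with_K5_def)
next
  fix G assume "G \<in> triangles_with_K5 T" "F \<subseteq> G"
  then show "G = F"
    using triangles_with_K5_face[OF assms(1), of G] assms
    by (metis card_seteq triples_def)
qed

lemma weakly_closed_labels_triangles_with_K5:
  assumes T: "triples T"
    and adj: "\<And>F g. \<lbrakk>F \<in> T; g \<in> {1..5}; g \<notin> F; Min F < g; g < Max F\<rbrakk>
      \<Longrightarrow> \<exists>G\<in>T. g \<in> G \<and> card (G \<inter> F) = 2"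
  shows "weakly_closed_labels (triangles_with_K5 T)"
  unfolding weakly_closed_labels_def
proof (intro allI impI, elim conjE)
  fix F g
  assume F: "facet (triangles_with_K5 T) F" "F \<noteq> {}" and g: "g \<notin> F" "Min F < g" "g < Max F"
  have FD: "F \<in> triangles_with_K5 T" using F by (simp add: facet_def)
  note face = triangles_with_K5_face[OF T FD]
  have mF: "Min F \<in> F" "Max F \<in> F" using face F by auto
  then have g5: "g \<in> {1..5}" using face(1) g by fastforce
  show "\<exists>G\<in>triangles_with_K5 T. card G = card F \<and> adjacent G F \<and> g \<in> G"
  proof (cases "F \<in> T")
    case True
    then obtain G where G: "G \<in> T" "g \<in> G" "card (G \<inter> F) = 2"
      using adj[OF _ g5 g] by blast
    moreover have "card G = 3" "card F = 3" using T True G by (auto simp: triples_def)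
    ultimately show ?thesis
      by (intro bexI[of _ G]) (auto simp: adjacent_def face_dim_def triangles_with_K5_def)
  next
    case False
    then have "card F \<le> 2" using FD by (auto simp: triangles_with_K5_def)
    \<comment> \<open>The element \<open>g\<close> strictly between the extremes makes them
      distinct, so \<open>F\<close> is an edge; then \<open>{Min F, g}\<close> is the required
      neighbour.\<close>
    moreover have "card {Min F, Max F} = 2" using g by simp
    ultimately have F2: "F = {Min F, Max F}" "card F = 2"
      using card_seteq[of F "{Min F, Max F}"] face(2) mF by auto
    let ?G = "{Min F, g}"
    have "?G \<in> triangles_with_K5 T"
      using g5 mF face(1) g by (auto simp: triangles_with_K5_def)
    moreover have "card ?G = 2" using g by simp
    moreover have "?G \<inter> F = {Min F}" using g mF by auto
    ultimately show ?thesis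
      using F2(2) by (intro bexI[of _ ?G]) (auto simp: adjacent_def face_dim_def)
  qed
qed

lemma skeleton_weakly_chordal_labels_triangles_with_K5:
  assumes T: "triples T"
    and chord: "\<And>f g. \<lbrakk>f \<in> T; g \<in> T; f \<noteq> g; Max f = Max g\<rbrakk>
      \<Longrightarrow> \<exists>h\<in>T. h \<subseteq> (f \<union> g) - {Max f}"
  shows "skeleton_weakly_chordal_labels (triangles_with_K5 T)"
  unfolding skeleton_weakly_chordal_labels_def
proof (intro ballI impI, elim conjE)
  fix f g
  assume f: "f \<in> triangles_with_K5 T" and g: "g \<in> triangles_with_K5 T"
    and fg: "f \<noteq> g" "card f = card g" "Max f = Max g"
  note face = triangles_with_K5_face[OF T f] triangles_with_K5_face[OF T g]
  show "\<exists>h\<in>triangles_with_K5 T. card h = card f \<and> h \<subseteq> f \<union> g - {Max f}"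
  proof (cases "card f \<le> 2")
    case True
    have ne: "f \<noteq> {}" using face fg by auto
    then have m: "Max f \<in> f" "Max f \<in> g" using face fg by (metis Max_in card_0_eq)+
    let ?U = "f \<union> g - {Max f}"
    have "\<not> g \<subseteq> f" using fg face by (metis card_subset_eq)
    \<comment> \<open>The union has an element to spare, so deleting the maximum leaves room for a
      set of the size of \<open>f\<close>, and any such set is a face.\<close>
    then have "card f < card (f \<union> g)"
      using face by (intro psubset_card_mono) auto
    then have "card f \<le> card ?U" using m face by simp
    then obtain h where h: "h \<subseteq> ?U" "card h = card f"
      by (meson obtain_subset_with_card_n)
    then have "h \<in> triangles_with_K5 T" using face True by (auto simp: triangles_with_K5_def)
    then show ?thesis using h by blast
  next
    case False
    then have "f \<in> T" "g \<in> T" using f g fg by (auto simp: triangles_with_K5_def)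
    moreover from this obtain h where "h \<in> T" "h \<subseteq> f \<union> g - {Max f}"
      using chord fg by blast
    ultimately show ?thesis using T
      by (intro bexI[of _ h]) (auto simp: triangles_with_K5_def triples_def)
  qed
qed

section \<open>Increasing triples and the obstruction to an underclosed labeling\<close>

lemma triple_sorted:
  assumes "card F = 3"
  obtains a b c :: nat where "F = {a, b, c}" "a < b" "b < c"
proof -
  obtain x y z where F: "F = {x, y, z}" "x \<noteq> y" "y \<noteq> z" "x \<noteq> z"
    using assms by (auto simp: card_3_iff)
  define a c where "a = min x (min y z)" and "c = max x (max y z)"
  show ?thesis
  \<comment> \<open>The middle element is the total minus the two extremes.\<close>
  proof (rule that[of a "x + y + z - a - c" c])
  qed (use F in \<open>auto simp: a_def c_def min_def max_def\<close>)
qed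

lemma sorted_list_of_triple:
  fixes a b c :: "'b::linorder"
  assumes "a < b" "b < c"
  shows "sorted_list_of_set {a, b, c} = [a, b, c]"
proof -
  have "sorted [a, b, c]" "distinct [a, b, c]" using assms by auto
  from sorted_list_of_set.idem_if_sorted_distinct[OF this] show ?thesis by simp
qed

text \<open>Sorted lists are canonical; as a rewrite rule this separates concrete triangles.\<close>

lemma triple_eq_iff:
  fixes a b c :: "'b::linorder"
  assumes "a < b" "b < c" "a' < b'" "b' < c'"
  shows "{a, b, c} = {a', b', c'} \<longleftrightarrow> a = a' \<and> b = b' \<and> c = c'"
  using sorted_list_of_triple[OF assms(1,2)] sorted_list_of_triple[OF assms(3,4)]
  by (metis list.inject)

lemma underclosed_labels_triple:
  assumes T: "triples T" and u: "underclosed_labels (triangles_with_K5 T)"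
    and F: "{a, b, c} \<in> T" "a < b" "b < c"
    and G: "a < b'" "b' < c'" "b' \<le> b" "c' \<le> c"
  shows "{a, b', c'} \<in> T"
proof -
  have "comp_le {a, b', c'} {a, b, c}"
    using F G by (simp add: comp_le_def sorted_list_of_triple)
  moreover have "{a, b', c'} \<subseteq> {1..card (vertices (triangles_with_K5 T))}"
    using T F G by (auto simp: vertices_triangles_with_K5 triples_def)
  moreover have "card {a, b', c'} = card {a, b, c}" "Min {a, b', c'} = Min {a, b, c}"
    using F G by auto
  ultimately have "{a, b', c'} \<in> triangles_with_K5 T"
    using u facet_triangle[OF T F(1)] unfolding underclosed_labels_def by blast
  \<comment> \<open>A face with three elements is not in the graph part, so it comes from
    \<open>T\<close>.\<close>
  then show ?thesis using G by (auto simp: triangles_with_K5_def)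
qed

text \<open>A counting contradiction: being closed downwards while avoiding three pairwise adjacent
  triangles leaves at most three triangles.\<close>

lemma not_underclosed_labels_triangles_with_K5:
  assumes T: "triples T" "card T = 4"
    and deg: "\<exists>F\<in>T. \<exists>G\<in>T. F \<noteq> G \<and> 1 \<in> F \<and> 1 \<in> G"
    and no3: "\<And>F G H. \<lbrakk>F \<in> T; G \<in> T; H \<in> T; card (F \<inter> G) = 2; card (G \<inter> H) = 2\<rbrakk>
      \<Longrightarrow> card (F \<inter> H) \<noteq> 2"
  shows "\<not> underclosed_labels (triangles_with_K5 T)"
proof
  assume u: "underclosed_labels (triangles_with_K5 T)"
  note down = underclosed_labels_triple[OF T(1) u]
  have form: "\<exists>a b c. F = {a, b, c} \<and> 1 \<le> a \<and> a < b \<and> b < c \<and> c \<le> 5" if "F \<in> T" for F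
  proof -
    have "F \<subseteq> {1..5}" "card F = 3" using T that by (auto simp: triples_def)
    then show ?thesis by (elim triple_sorted) auto
  qed
  have form1: "\<exists>b c. F = {1, b, c} \<and> 1 < b \<and> b < c \<and> c \<le> 5" if "F \<in> T" "1 \<in> F" for F
    using form[OF that(1)] that(2) by force
  obtain F where F: "F \<in> T" "1 \<in> F" "F \<noteq> {1, 2, 3}" using deg by metis
  then obtain b c where bc: "F = {1, b, c}" "1 < b" "b < c" "c \<le> 5" using form1 by blast
  \<comment> \<open>Any triangle through 1 other than \<open>{1, 2, 3}\<close> thus dominates both
    \<open>{1, 2, 3}\<close> and \<open>{1, 2, 4}\<close>.\<close>
  have "4 \<le> c"
  proof (rule ccontr)
    assume "\<not> 4 \<le> c"
    then have "b = 2" "c = 3" using bc(2,3) by linarith+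
    then show False using F(3) bc(1) by simp
  qed
  then have t: "{1, 2, 3} \<in> T" "{1, 2, 4} \<in> T"
    using down[of 1 b c 2 3] down[of 1 b c 2 4] F bc by auto
  \<comment> \<open>Each of these is adjacent to both \<open>{1, 2, 3}\<close> and
    \<open>{1, 2, 4}\<close>, which are adjacent to each other.\<close>
  have no: "H \<notin> T" if "H = {1, 2, 5} \<or> H = {1, 3, 4} \<or> H = {2, 3, 4}" for H
  proof
    assume H: "H \<in> T"
    have "card ({1, 2, 3} \<inter> {1, 2, 4::nat}) = 2"
      "card ({1, 2, 4} \<inter> H) = 2" "card ({1, 2, 3} \<inter> H) = 2"
      using that by (elim disjE; simp)+
    then show False using no3[OF t H] by simp
  qed
  have "T \<subseteq> {{1, 2, 3}, {1, 2, 4}, {3, 4, 5}}"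
  proof
    fix F assume "F \<in> T"
    then obtain a b c where abc: "F = {a, b, c}" "1 \<le> a" "a < b" "b < c" "c \<le> 5"
      using form by metis
    then have d: "{a, b', c'} \<in> T" if "a < b'" "b' < c'" "b' \<le> b" "c' \<le> c" for b' c'
      using \<open>F \<in> T\<close> down that by blast
    \<comment> \<open>With \<open>a = 1\<close> and \<open>b\<close> at least 3 the triple dominates
      \<open>{1, 3, 4}\<close>; with \<open>a = 2\<close> it dominates \<open>{2, 3, 4}\<close>.
      Both are excluded.\<close>
    consider "a = 1" "b = 2" "c = 3" | "a = 1" "b = 2" "c = 4" | "a = 1" "b = 2" "c = 5"
      | "a = 1" "3 \<le> b" | "a = 2" | "a = 3" "b = 4" "c = 5"
      using abc by linarith
    then show "F \<in> {{1, 2, 3}, {1, 2, 4}, {3, 4, 5}}"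
    proof cases
      case 3
      then have "F = {1, 2, 5}" using abc(1) by blast
      then show ?thesis using no[of F] \<open>F \<in> T\<close> by blast
    next
      case 4
      then show ?thesis using no[of "{1, 3, 4}"] d[of 3 4] abc by simp
    next
      case 5
      then show ?thesis using no[of "{2, 3, 4}"] d[of 3 4] abc by simp
    qed (use abc(1) in blast)+
  qed
  then have "card T \<le> card {{1, 2, 3}, {1, 2, 4}, {3, 4, 5::nat}}"
    by (intro card_mono) auto
  also have "\<dots> \<le> 3" by (simp add: card_insert_if)
  finally show False using T by simp
qed

section \<open>The path of triangles 124, 123, 135, 345, consecutive ones sharing an edge\<close>

definition path4 :: "nat set set" where
  "path4 = {{1, 2, 3}, {1, 2, 4}, {1, 3, 5}, {3, 4, 5}}"

lemma triples_path4: "triples path4"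
  by (simp add: triples_def path4_def)

lemma card_path4: "card path4 = 4"
proof -
  have "distinct [{1, 2, 3}, {1, 2, 4}, {1, 3, 5}, {3, 4, 5 :: nat}]"
    by (simp add: triple_eq_iff)
  then show ?thesis unfolding path4_def using distinct_card by force
qed

text \<open>The identity labeling works. Only 124 and 135 have gaps: 123 fills the gap 3 of the
  former and the gap 2 of the latter, while 345 fills the gap 4.\<close>

lemma weakly_closed_path4: "weakly_closed (triangles_with_K5 path4)"
proof -
  have "weakly_closed_labels (triangles_with_K5 path4)"
  proof (rule weakly_closed_labels_triangles_with_K5[OF triples_path4])
    fix F g assume F: "F \<in> path4" and g: "g \<in> {1..5}" "g \<notin> F" "Min F < g" "g < Max F"
    have "g = 3" if "F = {1, 2, 4}" using that g by auto
    moreover have "g = 2 \<or> g = 4" if "F = {1, 3, 5}" using that g by auto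
    moreover have "F \<noteq> {1, 2, 3}" "F \<noteq> {3, 4, 5}" using g by auto
    ultimately consider "F = {1, 2, 4}" "g = 3" | "F = {1, 3, 5}" "g = 2" | "F = {1, 3, 5}" "g = 4"
      using F by (auto simp: path4_def)
    then show "\<exists>G\<in>path4. g \<in> G \<and> card (G \<inter> F) = 2"
      by cases (simp_all add: path4_def Int_insert_left)
  qed
  moreover have "relabel (\<lambda>x. x) D = D" for D by (simp add: relabel_def)
  moreover have "labeling (triangles_with_K5 path4) (\<lambda>x. x)"
    by (simp add: labeling_def vertices_triangles_with_K5 triples_path4 bij_betw_def)
  ultimately show ?thesis unfolding weakly_closed_def by metis
qed

lemma skeleton_weakly_chordal_path4: "skeleton_weakly_chordal (triangles_with_K5 path4)"
proof -
  \<comment> \<open>In the identity labeling, 135 and 345 share the maximum 5 and would force the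
    non-face 134. After the swap the only pair with a common maximum is 125 and 345, and 123 serves
    as \<open>h\<close>.\<close>
  let ?l = "transpose 4 (5::nat)"
  have l: "bij_betw ?l {1..5} {1..5}" by simp
  have r: "relabel ?l path4 = {{1, 2, 3}, {1, 2, 5}, {1, 3, 4}, {3, 4, 5}}"
    by (simp add: relabel_def path4_def insert_commute)
  have "skeleton_weakly_chordal_labels (triangles_with_K5 (relabel ?l path4))"
  proof (rule skeleton_weakly_chordal_labels_triangles_with_K5)
    show "triples (relabel ?l path4)"
      by (rule relabel_triangles_with_K5[OF triples_path4 l])
    fix f g assume "f \<in> relabel ?l path4" "g \<in> relabel ?l path4" "f \<noteq> g" "Max f = Max g"
    then have "f \<union> g = {1, 2, 3, 4, 5}" "Max f = 5"
      by (auto simp: r)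
    then show "\<exists>h\<in>relabel ?l path4. h \<subseteq> f \<union> g - {Max f}"
      by (auto simp: r)
  qed
  moreover have "labeling (triangles_with_K5 path4) ?l"
    using l by (simp add: labeling_def vertices_triangles_with_K5 triples_path4)
  ultimately show ?thesis
    unfolding skeleton_weakly_chordal_def
    using relabel_triangles_with_K5(1)[OF triples_path4 l] by metis
qed

text \<open>Needed at every vertex, since any of them may receive the label 1.\<close>

lemma path4_vertex_degree:
  assumes "x \<in> {1..5}"
  shows "\<exists>F\<in>path4. \<exists>G\<in>path4. F \<noteq> G \<and> x \<in> F \<and> x \<in> G"
proof -
  have "x = 1 \<or> x = 2 \<or> x = 3 \<or> x = 4 \<or> x = 5"
    using assms unfolding atLeastAtMost_iff by linarith
  then consider "x = 1 \<or> x = 2" | "x = 4" | "x = 3 \<or> x = 5" by blast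
  then show ?thesis
  proof cases
    case 1
    then have "x \<in> {1, 2, 3}" "x \<in> {1, 2, 4}" by auto
    moreover have "{1, 2, 3} \<in> path4" "{1, 2, 4} \<in> path4" "{1, 2, 3} \<noteq> {1, 2, 4::nat}"
      by (simp_all add: path4_def triple_eq_iff)
    ultimately show ?thesis by metis
  next
    case 2
    then have "x \<in> {1, 2, 4}" "x \<in> {3, 4, 5}" by auto
    moreover have "{1, 2, 4} \<in> path4" "{3, 4, 5} \<in> path4" "{1, 2, 4} \<noteq> {3, 4, 5::nat}"
      by (simp_all add: path4_def triple_eq_iff)
    ultimately show ?thesis by metis
  next
    case 3
    then have "x \<in> {1, 3, 5}" "x \<in> {3, 4, 5}" by auto
    moreover have "{1, 3, 5} \<in> path4" "{3, 4, 5} \<in> path4" "{1, 3, 5} \<noteq> {3, 4, 5::nat}"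
      by (simp_all add: path4_def triple_eq_iff)
    ultimately show ?thesis by metis
  qed
qed

text \<open>The sum of the vertices alternates in parity along the path of triangles.\<close>

lemma path4_adjacent_parity:
  assumes "F \<in> path4" "G \<in> path4" "card (F \<inter> G) = 2"
  shows "even (\<Sum>F) \<noteq> even (\<Sum>G)"
proof -
  have "F = {1, 2, 3} \<or> F = {1, 2, 4} \<or> F = {1, 3, 5} \<or> F = {3, 4, 5}"
    "G = {1, 2, 3} \<or> G = {1, 2, 4} \<or> G = {1, 3, 5} \<or> G = {3, 4, 5}"
    using assms by (simp_all add: path4_def)
  then show ?thesis
    using assms(3) by (elim disjE; hypsubst; simp)
qed

text \<open>A labeling is injective on the vertices, so it preserves the sizes of intersections, and
  the obstruction applies to the image of \<open>path4\<close>.\<close>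

lemma not_underclosed_path4: "\<not> underclosed (triangles_with_K5 path4)"
proof
  assume "underclosed (triangles_with_K5 path4)"
  then obtain l where "labeling (triangles_with_K5 path4) l"
    and u: "underclosed_labels (relabel l (triangles_with_K5 path4))"
    by (auto simp: underclosed_def)
  then have l: "bij_betw l {1..5} {1..5}"
    by (simp add: labeling_def vertices_triangles_with_K5 triples_path4)
  then have inj: "inj_on l {1..5}" and surj: "l ` {1..5} = {1..5}"
    by (simp_all add: bij_betw_def)
  have sub: "F \<subseteq> {1..5}" if "F \<in> path4" for F
    using that triples_path4 by (simp add: triples_def)
  have inj_image: "l ` F = l ` G \<longleftrightarrow> F = G" if "F \<in> path4" "G \<in> path4" for F G
    using inj_on_image_eq_iff[OF inj] sub that by simp
  have inter: "card (l ` F \<inter> l ` G) = card (F \<inter> G)" if "F \<in> path4" "G \<in> path4" for F G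
  proof -
    have "l ` F \<inter> l ` G = l ` (F \<inter> G)"
      using inj_on_image_Int[OF inj] sub that by simp
    moreover have "inj_on l (F \<inter> G)"
      by (rule inj_on_subset[OF inj]) (use sub[OF that(1)] in blast)
    ultimately show ?thesis by (simp add: card_image)
  qed
  have "\<not> underclosed_labels (triangles_with_K5 (relabel l path4))"
  proof (rule not_underclosed_labels_triangles_with_K5)
    show "triples (relabel l path4)"
      by (rule relabel_triangles_with_K5[OF triples_path4 l])
    show "card (relabel l path4) = 4"
      using inj_image card_path4 by (simp add: relabel_def card_image inj_on_def)
    have "1 \<in> l ` {1..5}" using surj by simp
    then obtain x where x: "x \<in> {1..5}" "l x = 1" by (metis imageE)
    obtain F G where FG: "F \<in> path4" "G \<in> path4" "F \<noteq> G" "x \<in> F" "x \<in> G"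
      using path4_vertex_degree[OF x(1)] by blast
    show "\<exists>F\<in>relabel l path4. \<exists>G\<in>relabel l path4. F \<noteq> G \<and> 1 \<in> F \<and> 1 \<in> G"
    proof (intro bexI conjI)
      show "l ` F \<noteq> l ` G" using inj_image FG by simp
      show "1 \<in> l ` F" "1 \<in> l ` G" using FG x(2) by (metis imageI)+
      show "l ` F \<in> relabel l path4" "l ` G \<in> relabel l path4"
        using FG by (simp_all add: relabel_def)
    qed
  next
    fix F G H
    assume FGH: "F \<in> relabel l path4" "G \<in> relabel l path4" "H \<in> relabel l path4"
      and card: "card (F \<inter> G) = 2" "card (G \<inter> H) = 2"
    obtain F' G' H' where *: "F' \<in> path4" "G' \<in> path4" "H' \<in> path4"
      "F = l ` F'" "G = l ` G'" "H = l ` H'"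
      using FGH unfolding relabel_def by blast
    then have "card (F' \<inter> G') = 2" "card (G' \<inter> H') = 2"
      using card inter by simp_all
    \<comment> \<open>Both \<open>F'\<close> and \<open>H'\<close> differ in parity from
      \<open>G'\<close>, so they agree with each other and cannot be adjacent.\<close>
    then have "card (F' \<inter> H') \<noteq> 2"
      using path4_adjacent_parity * by metis
    then show "card (F \<inter> H) \<noteq> 2" using inter * by simp
  qed
  then show False
    using u relabel_triangles_with_K5(1)[OF triples_path4 l] by simp
qed

theorem corollary41:
  "(\<forall>D :: 'a set set. simplicial_complex D \<and> underclosed D
       \<longrightarrow> weakly_closed D \<and> skeleton_weakly_chordal D)
   \<and> (\<exists>D :: nat set set. simplicial_complex D \<and> weakly_closed D
       \<and> skeleton_weakly_chordal D \<and> \<not> underclosed D)"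
  using underclosed_imp simplicial_complex_triangles_with_K5[OF triples_path4]
    weakly_closed_path4 skeleton_weakly_chordal_path4 not_underclosed_path4
  by blast

end
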